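(* Let $n\ge1$ be a fixed degree and $\omega\in(0,(n+1)\pi)$. The interpolation nodes $\mathrm{i}x_1,\dots,\mathrm{i}x_{2n+1}$ and the equioscillation points $\eta_1,\dots,\eta_{2n+2}$ of the unitary best approximation to $\mathrm{e}^{\mathrm{i}\omega x}$ in $\mathcal{U}_n$ are mirrored around the origin, i.e., the sets $\{\mathrm{i}x_1,\dots,\mathrm{i}x_{2n+1}\}$ and $\{\eta_1,\dots,\eta_{2n+2}\}$ are invariant under $y\mapsto -y$.
   Context: For a complex polynomial $p$ let $p^\dag(z):=\overline{p}(-z)=\overline{p(-\overline z)}$, where $\overline p$ has complex-conjugated coefficients. Let $\mathcal{U}_n:=\{p^\dag/p : p \text{ a complex polynomial of degree}\le n,\ p\not\equiv 0\}$, with rational functions identified with their irreducible form; then $|r(\mathrm{i}x)|=1$ for $r\in\mathcal{U}_n$, $x\in\mathbb{R}$. For $r\in\mathcal{U}_n$, $\|r-\exp(\omega\cdot)\|:=\max_{x\in[-1,1]}|r(\mathrm{i}x)-\mathrm{e}^{\mathrm{i}\omega x}|$. For $\omega\in(0,(n+1)\pi)$ the unitary best approximation is the (existing and unique) $r\in\mathcal{U}_n$ with $\|r-\exp(\omega\cdot)\|=\min_{u\in\mathcal{U}_n}\|u-\exp(\omega\cdot)\|$; this minimum is $<2$. Phase function: if $r\in\mathcal{U}_n$ (in irreducible form) has poles $s_j=\xi_j+\mathrm{i}\mu_j$, $j=1,\dots,m$ (then $\xi_j\neq0$), and $\|r-\exp(\omega\cdot)\|<2$, then there is a unique function of the form $g(x)=\theta+2\sum_{j=1}^m\arctan\big(\frac{x-\mu_j}{\xi_j}\big)$,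 $\theta\in\mathbb{R}$, with $r(\mathrm{i}x)=\mathrm{e}^{\mathrm{i}g(x)}$ for $x\in\mathbb{R}$ and $\max_{x\in[-1,1]}|g(x)-\omega x|<\pi$. The phase error is $g(x)-\omega x$. For the unitary best approximation with $\omega\in(0,(n+1)\pi)$ there are exactly $2n+2$ points $-1=\eta_1<\dots<\eta_{2n+2}=1$ in $[-1,1]$ at which $|g(x)-\omega x|$ attains its maximum over $[-1,1]$, and the sign of the phase error alternates between consecutive ones; these are the equioscillation points. The phase error has exactly one zero $x_j\in(\eta_j,\eta_{j+1})$ for $j=1,\dots,2n+1$; the points $\mathrm{i}x_1,\dots,\mathrm{i}x_{2n+1}$ are the interpolation nodes (where $r(\mathrm{i}x_j)=\mathrm{e}^{\mathrm{i}\omega x_j}$). *)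

theory Defs
  imports
    Complex_Main
    "HOL-Computational_Algebra.Computational_Algebra"
    "HOL-Computational_Algebra.Field_as_Ring"
begin

definition poly_dag :: "complex poly \<Rightarrow> complex poly" where
  "poly_dag p = pcompose (map_poly cnj p) [:0, -1:]"

lemma poly_poly_dag: "poly (poly_dag p) z = cnj (poly p (- cnj z))"
proof -
  have "poly (map_poly cnj p) (- z) = cnj (poly p (- cnj z))"
    by (induction p) (auto simp: map_poly_pCons)
  then show ?thesis
    by (simp add: poly_dag_def poly_pcompose)
qed

text \<open>
  Rational functions are elements of the fraction field of \<open>complex poly\<close>; \<open>quot_of_fract\<close> selects
  the coprime representative with monic denominator, i.e. the irreducible form.
\<close>

definition rat_eval :: "complex poly fract \<Rightarrow> complex \<Rightarrow> complex" where
  "rat_eval r z = poly (fst (quot_of_fract r)) z / poly (snd (quot_of_fract r)) z"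

definition rat_poles :: "complex poly fract \<Rightarrow> complex multiset" where
  "rat_poles r = proots (snd (quot_of_fract r))"

definition unitary_rats :: "nat \<Rightarrow> complex poly fract set" where
  "unitary_rats n = {Fract (poly_dag p) p | p. degree p \<le> n \<and> p \<noteq> 0}"

text \<open>
  The suprema below are maxima of continuous functions on \<open>{-1..1}\<close> in all uses: members of
  \<open>unitary_rats n\<close> have no poles on the imaginary axis once in irreducible form.
\<close>

definition approx_error :: "real \<Rightarrow> complex poly fract \<Rightarrow> real" where
  "approx_error \<omega> r =
     (SUP x\<in>{-1..1::real}. cmod (rat_eval r (\<i> * of_real x) - exp (\<i> * of_real (\<omega> * x))))"

definition unitary_best_approx :: "nat \<Rightarrow> real \<Rightarrow> complex poly fract \<Rightarrow> bool" where
  "unitary_best_approx n \<omega> r \<longleftrightarrow>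
     r \<in> unitary_rats n \<and> (\<forall>u\<in>unitary_rats n. approx_error \<omega> r \<le> approx_error \<omega> u)"

definition phase_error :: "real \<Rightarrow> (real \<Rightarrow> real) \<Rightarrow> real \<Rightarrow> real" where
  "phase_error \<omega> g x = g x - \<omega> * x"

definition max_phase_error :: "real \<Rightarrow> (real \<Rightarrow> real) \<Rightarrow> real" where
  "max_phase_error \<omega> g = (SUP x\<in>{-1..1::real}. \<bar>phase_error \<omega> g x\<bar>)"

text \<open>Poles are counted with multiplicity.\<close>

definition phase_function :: "real \<Rightarrow> complex poly fract \<Rightarrow> (real \<Rightarrow> real) \<Rightarrow> bool" where
  "phase_function \<omega> r g \<longleftrightarrow>
     (\<exists>\<theta>. \<forall>x. g x = \<theta> + 2 * (\<Sum>s\<in>#rat_poles r. arctan ((x - Im s) / Re s))) \<and>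
     (\<forall>x. rat_eval r (\<i> * of_real x) = exp (\<i> * of_real (g x))) \<and>
     max_phase_error \<omega> g < pi"

text \<open>Finite sequences are functions on \<open>nat\<close>, relevant only on the stated index ranges from 1.\<close>

definition equioscillation_points ::
    "nat \<Rightarrow> real \<Rightarrow> (real \<Rightarrow> real) \<Rightarrow> (nat \<Rightarrow> real) \<Rightarrow> bool" where
  "equioscillation_points n \<omega> g \<eta> \<longleftrightarrow>
     strict_mono_on {1..2*n+2} \<eta> \<and> \<eta> 1 = -1 \<and> \<eta> (2*n+2) = 1 \<and>
     \<eta> ` {1..2*n+2} = {x\<in>{-1..1}. \<bar>phase_error \<omega> g x\<bar> = max_phase_error \<omega> g} \<and>
     (\<forall>j\<in>{1..2*n+1}. phase_error \<omega> g (\<eta> j) * phase_error \<omega> g (\<eta> (j+1)) < 0)"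

text \<open>The interpolation nodes themselves are the points \<open>\<i> * x j\<close>.\<close>

definition node_ordinates ::
    "nat \<Rightarrow> real \<Rightarrow> (real \<Rightarrow> real) \<Rightarrow> (nat \<Rightarrow> real) \<Rightarrow> (nat \<Rightarrow> real) \<Rightarrow> bool" where
  "node_ordinates n \<omega> g \<eta> x \<longleftrightarrow>
     (\<forall>j\<in>{1..2*n+1}. {t\<in>{\<eta> j<..<\<eta> (j+1)}. phase_error \<omega> g t = 0} = {x j})"

end

theory Submission
  imports Defs
begin

text \<open>
  Let \<open>\<phi> x = g x - \<omega> x\<close> be the phase error. Reflecting a unitary rational function,
  \<open>r z \<mapsto> 1 / r (- z)\<close>, turns the phase function \<open>g\<close> into \<open>\<lambda>x. - g (- x)\<close> and the phase error
  into \<open>\<lambda>x. - \<phi> (- x)\<close>, so the reflected function approximates equally well. Both claims follow once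
  \<open>\<phi>\<close> is known to be odd: the equioscillation points are the points of \<open>{-1..1}\<close> where \<open>\<bar>\<phi>\<bar>\<close> is
  maximal, and the nodes are the zeros of \<open>\<phi>\<close> there.

  Oddness says that the reflected function is \<open>r\<close> itself, and as in Chebyshev approximation
  equioscillation gives this uniqueness by counting zeros. Write \<open>r = p\<^sup>\<dagger> / p\<close> where
  \<open>p\<close> has no zeros on the imaginary axis (\<open>unitary_rat_phase_denominator\<close>). On that axis \<open>p\<close> equals
  \<open>h e\<^sup>-\<^sup>i\<^sup>g\<^sup>/\<^sup>2\<close> with \<open>h\<close> real, continuous and free of zeros, hence of constant sign. Therefore the
  real polynomial \<open>P x = Im (p (\<i> x) p (- \<i> x))\<close>, of degree at most \<open>2 n\<close>, is at each point a negative multiple of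
  \<open>sin ((g x + g (- x)) / 2)\<close> (\<open>phase_reflection_polynomial\<close>). At an equioscillation point
  \<open>g x + g (- x) = \<phi> x + \<phi> (- x)\<close> cannot have the sign opposite to \<open>\<phi> x\<close>, because \<open>\<bar>\<phi> (- x)\<bar>\<close> does
  not exceed the maximum \<open>\<bar>\<phi> x\<bar>\<close>; and it stays below \<open>2 \<pi>\<close> in modulus, so that the sine of its half
  has the same sign. Thus \<open>P\<close> weakly alternates in sign at \<open>2 n + 2\<close> points, which makes it zero
  (\<open>poly_weakly_alternating_eq_0\<close>), and so \<open>g x + g (- x) = 0\<close> on \<open>{-1..1}\<close>.
\<close>

section \<open>Polynomials with weakly alternating signs\<close>

text \<open>
  The point of choosing the root well: dividing by \<open>x - c\<close> flips the sign to the left of \<open>c\<close> and must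
  not spoil the sign at \<open>b\<close>. This is automatic if \<open>c < b\<close>; if \<open>b\<close> is the only root in \<open>{a..b}\<close>,
  the cofactor is negative on \<open>{a..<b}\<close> and so nonpositive at \<open>b\<close>.
\<close>

lemma poly_root_split_sign:
  fixes P :: "real poly"
  assumes "a < b" "poly P a \<ge> 0" "poly P b \<le> 0"
  obtains c R where "P = [:-c, 1:] * R" "c \<le> b" "poly R b \<le> 0"
proof -
  note result = that
  have split: thesis if "c < b" "poly P c = 0" for c
  proof -
    obtain R where R: "P = [:-c, 1:] * R"
      using \<open>poly P c = 0\<close> by (auto simp: poly_eq_0_iff_dvd elim: dvdE)
    have "poly P b = (b - c) * poly R b"
      by (simp add: R algebra_simps)
    with assms(3) \<open>c < b\<close> have "poly R b \<le> 0"
      by (simp add: mult_le_0_iff)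
    with R \<open>c < b\<close> show thesis
      by (intro result[of c R]) auto
  qed
  obtain c where c: "a \<le> c" "c \<le> b" "poly P c = 0"
    using IVT2[of "poly P" b 0 a] assms by auto
  show thesis
  proof (cases "c < b \<or> poly P a = 0")
    case True
    then show thesis
      using split[of c] split[of a] c assms(1) by blast
  next
    case False
    with c have "c = b" "poly P a > 0"
      using assms(2) by auto
    obtain R where R: "P = [:-b, 1:] * R"
      using c \<open>c = b\<close> by (auto simp: poly_eq_0_iff_dvd elim: dvdE)
    have "poly P a = (a - b) * poly R a"
      by (simp add: R algebra_simps)
    with \<open>poly P a > 0\<close> \<open>a < b\<close> have "poly R a < 0"
      by (simp add: zero_less_mult_iff)
    show thesis
    proof (cases "poly R b \<le> 0")
      case True
      with R show thesis
        by (intro result[of b R]) auto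
    next
      case False
      then obtain d where d: "d < b" "poly R d = 0"
        using poly_IVT_pos[of a b R] \<open>poly R a < 0\<close> \<open>a < b\<close> by auto
      then have "poly P d = 0"
        by (simp add: R)
      with d split show thesis
        by blast
    qed
  qed
qed

text \<open>
  Zero counting with multiplicities, done by splitting off one root per sign change.
\<close>

lemma poly_weakly_alternating_eq_0:
  fixes P :: "real poly" and t :: "nat \<Rightarrow> real"
  assumes "degree P \<le> N"
    and "\<And>j. j \<le> N \<Longrightarrow> t j < t (Suc j)"
    and "\<And>j. j \<le> Suc N \<Longrightarrow> (-1) ^ j * poly P (t j) \<ge> 0"
  shows "P = 0"
  using assms
proof (induction N arbitrary: P t)
  case 0
  then obtain c where "P = [:c:]"
    by (auto elim: degree_eq_zeroE)
  then show ?case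
    using "0.prems"(3)[of 0] "0.prems"(3)[of 1] by auto
next
  case (Suc N)
  obtain c R where R: "P = [:-c, 1:] * R" "c \<le> t 1" "poly R (t 1) \<le> 0"
    using poly_root_split_sign[of "t 0" "t 1" P]
      Suc.prems(2)[of 0] Suc.prems(3)[of 0] Suc.prems(3)[of 1] by auto
  have step: "t j < t (Suc j)" if "j \<le> Suc N" for j
    using Suc.prems(2) that .
  have mono: "t 1 < t (Suc (Suc k))" if "k \<le> N" for k
    using that
  proof (induction k)
    case 0
    show ?case using step[of 1] by simp
  next
    case (Suc k)
    then show ?case using step[of "Suc (Suc k)"] by simp
  qed
  have "- R = 0"
  proof (rule Suc.IH)
    show "degree (- R) \<le> N"
    proof (cases "R = 0")
      case False
      then have "degree P = Suc (degree R)"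
        by (simp add: R(1) degree_mult_eq del: mult_pCons_left)
      then show ?thesis using Suc.prems(1) by simp
    qed simp
    show "t (Suc j) < t (Suc (Suc j))" if "j \<le> N" for j
      using Suc.prems(2)[of "Suc j"] that by simp
    show "(-1) ^ j * poly (- R) (t (Suc j)) \<ge> 0" if "j \<le> Suc N" for j
    proof (cases j)
      case 0
      with R(3) show ?thesis by simp
    next
      case (Suc k)
      have pos: "t (Suc j) - c > 0"
        using mono[of k] R(2) that Suc by simp
      have "(t (Suc j) - c) * ((-1) ^ j * poly (- R) (t (Suc j))) = (-1) ^ Suc j * poly P (t (Suc j))"
        by (simp add: R(1) algebra_simps)
      also have "\<dots> \<ge> 0"
        using Suc.prems(3)[of "Suc j"] that by simp
      finally show ?thesis
        using pos by (metis zero_le_mult_iff not_less less_imp_le)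
    qed
  qed
  then show ?case by (simp add: R(1))
qed

section \<open>The denominator on the imaginary axis\<close>

lemma poly_dag_mult: "poly_dag (p * q) = poly_dag p * poly_dag q"
proof -
  have "poly (poly_dag (p * q)) = poly (poly_dag p * poly_dag q)"
    by (rule ext) (simp add: poly_poly_dag)
  then show ?thesis
    by (simp only: poly_eq_poly_eq_iff)
qed

text \<open>
  A zero \<open>z\<close> on the imaginary axis satisfies \<open>z = - cnj z\<close>, so the corresponding linear factor cancels
  from \<open>p\<^sup>\<dagger> / p\<close> up to the sign \<open>-1\<close>; this sign is \<open>\<i>\<^sup>\<dagger> / \<i>\<close> and can be absorbed into \<open>p\<close>.
  A representation of minimal degree therefore has no such zero.
\<close>

lemma dag_quotient_imaginary_zero_free:
  assumes "p \<noteq> 0" "poly_dag p * b = a * p"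
  obtains q where "q \<noteq> 0" "degree q \<le> degree p" "poly_dag q * b = a * q"
    "\<And>x. poly q (\<i> * of_real x) \<noteq> 0"
  using assms
proof (induction "degree p" arbitrary: p thesis rule: less_induct)
  case less
  show thesis
  proof (cases "\<exists>x. poly p (\<i> * of_real x) = 0")
    case False
    with less.prems show thesis by blast
  next
    case True
    then obtain y where y: "poly p (\<i> * of_real y) = 0" by blast
    let ?l = "[:- (\<i> * of_real y), 1:]"
    obtain s where s: "p = ?l * s"
      using y by (auto simp: poly_eq_0_iff_dvd elim: dvdE)
    have "s \<noteq> 0"
      using s less.prems(2) by auto
    then have deg: "degree p = Suc (degree s)"
      by (simp add: s degree_mult_eq del: mult_pCons_left)
    have dag_l: "poly_dag ?l = - ?l" and dag_i: "poly_dag [:\<i>:] = - [:\<i>:]"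
      by (simp_all add: poly_dag_def map_poly_pCons pcompose_pCons)
    have "?l * (- (poly_dag s * b)) = poly_dag p * b"
      unfolding s poly_dag_mult dag_l by (simp only: mult_minus_left mult_minus_right mult.assoc)
    also have "\<dots> = ?l * (a * s)"
      unfolding less.prems(3) by (simp only: s mult.left_commute)
    finally have "?l * (- (poly_dag s * b)) = ?l * (a * s)" .
    then have cancel: "- (poly_dag s * b) = a * s"
      by (subst (asm) mult_cancel_left) auto
    have "poly_dag ([:\<i>:] * s) * b = [:\<i>:] * (- (poly_dag s * b))"
      unfolding poly_dag_mult dag_i by (simp only: mult_minus_left mult_minus_right mult.assoc)
    also have "\<dots> = a * ([:\<i>:] * s)"
      unfolding cancel by (simp only: algebra_simps)
    finally have eq: "poly_dag ([:\<i>:] * s) * b = a * ([:\<i>:] * s)" .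
    have nz: "[:\<i>:] * s \<noteq> 0" and deg': "degree ([:\<i>:] * s) = degree s"
      using \<open>s \<noteq> 0\<close> by auto
    show thesis
    proof (rule less.hyps[OF _ _ nz eq])
      show "degree ([:\<i>:] * s) < degree p"
        by (simp add: deg deg' del: mult_pCons_left)
      show thesis if "q \<noteq> 0" "degree q \<le> degree ([:\<i>:] * s)" "poly_dag q * b = a * q"
        "\<And>x. poly q (\<i> * of_real x) \<noteq> 0" for q
        using less.prems(1)[of q] that by (simp add: deg deg' del: mult_pCons_left)
    qed
  qed
qed

lemma unitary_rat_phase_denominator:
  assumes "r \<in> unitary_rats n" "phase_function \<omega> r g"
  obtains p where "degree p \<le> n" "\<And>x. poly p (\<i> * of_real x) \<noteq> 0"
    "\<And>x. cnj (poly p (\<i> * of_real x)) = cis (g x) * poly p (\<i> * of_real x)"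
proof -
  define a b where "a = fst (quot_of_fract r)" and "b = snd (quot_of_fract r)"
  obtain p0 where p0: "r = Fract (poly_dag p0) p0" "degree p0 \<le> n" "p0 \<noteq> 0"
    using assms(1) by (auto simp: unitary_rats_def)
  have "b \<noteq> 0"
    by (simp add: b_def)
  have "Fract a b = r"
    by (simp add: a_def b_def)
  then have "poly_dag p0 * b = a * p0"
    using p0 \<open>b \<noteq> 0\<close> by (simp add: eq_fract)
  then obtain p where p: "degree p \<le> degree p0" "poly_dag p * b = a * p"
      and nz: "\<And>x. poly p (\<i> * of_real x) \<noteq> 0"
    using dag_quotient_imaginary_zero_free[OF \<open>p0 \<noteq> 0\<close>] by metis
  have "cnj (poly p (\<i> * of_real x)) = cis (g x) * poly p (\<i> * of_real x)" for x
  proof -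
    let ?z = "\<i> * complex_of_real x"
    have ab: "poly a ?z / poly b ?z = cis (g x)"
      using assms(2) by (simp add: phase_function_def rat_eval_def a_def b_def cis_conv_exp)
    \<comment> \<open>Division by zero yields zero, which is not a value of \<open>cis\<close>.\<close>
    then have "poly b ?z \<noteq> 0"
      using cis_neq_zero[of "g x"] by (metis div_by_0)
    have "cnj (poly p ?z) * poly b ?z = poly a ?z * poly p ?z"
      using arg_cong[OF p(2), of "\<lambda>q. poly q ?z"] by (simp add: poly_poly_dag)
    with \<open>poly b ?z \<noteq> 0\<close> show ?thesis
      by (simp add: ab[symmetric] field_simps)
  qed
  then show thesis
    using that[of p] p(1) p0(2) nz by simp
qed

lemma phase_function_continuous:
  assumes "phase_function \<omega> r g"
  shows "continuous_on A g"
proof -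
  have arctan_sum: "continuous_on A (\<lambda>x. \<Sum>s\<in>#M. arctan ((x - Im s) / Re s))"
    for M :: "complex multiset"
  proof (induction M)
    case (add s M)
    have "continuous_on A (\<lambda>x. arctan (inverse (Re s) * (x - Im s)))"
      by (intro continuous_intros)
    with add show ?case
      by (simp add: divide_inverse mult.commute continuous_on_add)
  qed simp
  obtain \<theta> where "g = (\<lambda>x. \<theta> + 2 * (\<Sum>s\<in>#rat_poles r. arctan ((x - Im s) / Re s)))"
    using assms by (auto simp: phase_function_def)
  then show ?thesis
    by (simp only:) (intro continuous_intros arctan_sum)
qed

section \<open>The symmetric part of the phase\<close>

lemma poly_map_poly_Im: "poly (map_poly Im Q) x = Im (poly Q (complex_of_real x))"
  by (induction Q) (auto simp: map_poly_pCons)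

text \<open>
  With \<open>p = h e\<^sup>-\<^sup>i\<^sup>g\<^sup>/\<^sup>2\<close> on the imaginary axis, \<open>p (\<i> x) p (- \<i> x)\<close> has modulus \<open>h x h (- x)\<close> and
  argument \<open>- (g x + g (- x)) / 2\<close>; the modulus is positive because \<open>h\<close> cannot change sign.
\<close>

lemma phase_reflection_polynomial:
  assumes "r \<in> unitary_rats n" "phase_function \<omega> r g"
  obtains P :: "real poly" and H :: "real \<Rightarrow> real" where
    "degree P \<le> 2 * n" "\<And>x. H x > 0" "\<And>x. poly P x = - H x * sin ((g x + g (- x)) / 2)"
proof -
  obtain p where deg: "degree p \<le> n" and nz: "\<And>x. poly p (\<i> * of_real x) \<noteq> 0"
    and ph: "\<And>x. cnj (poly p (\<i> * of_real x)) = cis (g x) * poly p (\<i> * of_real x)"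
    using unitary_rat_phase_denominator[OF assms] by blast
  define w where "w x = poly p (\<i> * of_real x) * cis (g x / 2)" for x
  define h where "h x = Re (w x)" for x
  have "cnj (w x) = w x" for x
  proof -
    have "cnj (w x) = poly p (\<i> * of_real x) * (cis (g x) * cis (- (g x / 2)))"
      by (simp add: w_def ph cis_cnj)
    also have "\<dots> = w x"
      by (simp add: w_def cis_mult)
    finally show ?thesis .
  qed
  then have wh: "w x = of_real (h x)" for x
    by (simp add: h_def complex_eq_iff)
  have h_nz: "h x \<noteq> 0" for x
    using wh[of x] nz[of x] by (auto simp: w_def)
  have h_cont: "continuous_on A h" for A
    unfolding h_def w_def cis_conv_exp
    by (intro continuous_intros phase_function_continuous[OF assms(2)]) auto
  have no_change: False if "u \<le> v" "h u \<le> 0 \<and> 0 \<le> h v \<or> h v \<le> 0 \<and> 0 \<le> h u" for u v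
    using IVT'[of h u 0 v] IVT2'[of h v 0 u] h_cont h_nz that by blast
  have h_pos: "h x * h (- x) > 0" for x
    using no_change[of x "-x"] no_change[of "-x" x] h_nz[of x] h_nz[of "-x"]
    by (smt (verit) zero_less_mult_iff)
  define Q where "Q = pcompose p [:0, \<i>:] * pcompose p [:0, -\<i>:]"
  have p_eq: "poly p (\<i> * of_real x) = of_real (h x) * cis (- (g x / 2))" for x
    by (simp add: wh[symmetric] w_def cis_mult mult.assoc)
  show thesis
  proof (rule that[of "map_poly Im Q" "\<lambda>x. h x * h (- x)"])
    have "degree Q \<le> degree (pcompose p [:0, \<i>:]) + degree (pcompose p [:0, -\<i>:])"
      unfolding Q_def by (rule degree_mult_le)
    also have "\<dots> = 2 * degree p"
      by (simp add: degree_pcompose)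
    finally have "degree Q \<le> 2 * n"
      using deg by linarith
    then show "degree (map_poly Im Q) \<le> 2 * n"
      by (intro degree_le) (simp add: coeff_map_poly coeff_eq_0)
    show "h x * h (- x) > 0" for x
      by (rule h_pos)
    show "poly (map_poly Im Q) x = - (h x * h (- x)) * sin ((g x + g (- x)) / 2)" for x
    proof -
      have "poly Q (of_real x) = poly p (\<i> * of_real x) * poly p (\<i> * of_real (- x))"
        by (simp add: Q_def poly_pcompose mult.commute)
      also have "\<dots> = of_real (h x * h (- x)) * cis (- ((g x + g (- x)) / 2))"
        unfolding p_eq by (simp add: cis_mult add_divide_distrib algebra_simps)
      finally show ?thesis
        by (simp add: poly_map_poly_Im)
    qed
  qed
qed

section \<open>Oddness of the phase error\<close>

lemma phase_error_le_max:
  assumes "phase_function \<omega> r g" "x \<in> {-1..1}"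
  shows "\<bar>phase_error \<omega> g x\<bar> \<le> max_phase_error \<omega> g"
proof -
  have "continuous_on {-1..1} (\<lambda>x. \<bar>phase_error \<omega> g x\<bar>)"
    unfolding phase_error_def
    by (intro continuous_intros phase_function_continuous[OF assms(1)])
  then have "\<exists>u\<in>{-1..1}. \<forall>y\<in>{-1..1}. \<bar>phase_error \<omega> g y\<bar> \<le> \<bar>phase_error \<omega> g u\<bar>"
    using continuous_attains_sup[of "{-1..1::real}"] compact_Icc by fastforce
  then have "bdd_above ((\<lambda>x. \<bar>phase_error \<omega> g x\<bar>) ` {-1..1})"
    by (meson bdd_aboveI2)
  then show ?thesis
    unfolding max_phase_error_def using assms(2) by (rule cSUP_upper2) simp
qed

text \<open>
  An instance of uniqueness by equioscillation: \<open>x \<mapsto> - phase_error \<omega> g (- x)\<close> is the phase error of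
  the reflected function, and it has the same maximum.
\<close>

lemma phase_error_odd:
  assumes "r \<in> unitary_rats n" "phase_function \<omega> r g" "equioscillation_points n \<omega> g \<eta>"
    and "x \<in> {-1..1}"
  shows "phase_error \<omega> g (- x) = - phase_error \<omega> g x"
proof -
  let ?\<phi> = "phase_error \<omega> g" and ?E = "max_phase_error \<omega> g"
  obtain P :: "real poly" and H where deg: "degree P \<le> 2 * n" and H: "\<And>y. H y > 0"
    and P: "\<And>y. poly P y = - H y * sin ((g y + g (- y)) / 2)"
    using phase_reflection_polynomial[OF assms(1,2)] by metis
  have sym: "g y + g (- y) = ?\<phi> y + ?\<phi> (- y)" for y
    by (simp add: phase_error_def)
  have "?E < pi"
    using assms(2) by (simp add: phase_function_def)
  have bound: "\<bar>?\<phi> y\<bar> \<le> ?E" "\<bar>?\<phi> (- y)\<bar> \<le> ?E" if "y \<in> {-1..1}" for y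
    using phase_error_le_max[OF assms(2)] that by auto

  have eta: "\<eta> i \<in> {-1..1}" "\<bar>?\<phi> (\<eta> i)\<bar> = ?E" if "i \<in> {1..2*n+2}" for i
    using assms(3) that unfolding equioscillation_points_def by blast+
  have eta_less: "\<eta> (Suc j) < \<eta> (Suc (Suc j))" if "j \<le> 2 * n" for j
    using assms(3) that unfolding equioscillation_points_def strict_mono_on_def by auto
  have alternate: "(-1) ^ j * ?\<phi> (\<eta> (Suc j)) = ?\<phi> (\<eta> 1)" if "j \<le> Suc (2 * n)" for j
    using that
  proof (induction j)
    case (Suc j)
    have "?\<phi> (\<eta> (Suc j)) * ?\<phi> (\<eta> (Suc (Suc j))) < 0"
      using assms(3) Suc.prems unfolding equioscillation_points_def by auto
    moreover have "\<bar>?\<phi> (\<eta> (Suc j))\<bar> = \<bar>?\<phi> (\<eta> (Suc (Suc j)))\<bar>"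
      using eta(2)[of "Suc j"] eta(2)[of "Suc (Suc j)"] Suc.prems by simp
    ultimately have "?\<phi> (\<eta> (Suc (Suc j))) = - ?\<phi> (\<eta> (Suc j))"
      by (auto simp: abs_eq_iff mult_less_0_iff)
    then show ?case using Suc by simp
  qed simp

  \<comment> \<open>The reflected term cannot outweigh a phase error of maximal modulus.\<close>
  have sign: "?\<phi> y * poly P y \<le> 0" if "y \<in> {-1..1}" "\<bar>?\<phi> y\<bar> = ?E" for y
  proof (cases "?\<phi> y \<ge> 0")
    case True
    then have "?\<phi> y = ?E"
      using that(2) by simp
    then have "0 \<le> (g y + g (- y)) / 2 \<and> (g y + g (- y)) / 2 \<le> pi"
      using bound(2)[OF that(1)] \<open>?E < pi\<close> unfolding sym by (auto simp: abs_le_iff)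
    then have "sin ((g y + g (- y)) / 2) \<ge> 0"
      using sin_ge_zero by blast
    with True H[of y] show ?thesis
      by (simp add: P mult_nonneg_nonneg)
  next
    case False
    then have "?\<phi> y = - ?E"
      using that(2) by simp
    then have "0 \<le> - ((g y + g (- y)) / 2) \<and> - ((g y + g (- y)) / 2) \<le> pi"
      using bound(2)[OF that(1)] \<open>?E < pi\<close> unfolding sym by (auto simp: abs_le_iff field_simps)
    then have "sin (- ((g y + g (- y)) / 2)) \<ge> 0"
      using sin_ge_zero by blast
    then have "poly P y \<ge> 0"
      using H[of y] by (simp add: P mult_nonneg_nonpos)
    with False show ?thesis
      by (simp add: mult_nonpos_nonneg)
  qed

  have "smult (- ?\<phi> (\<eta> 1)) P = 0"
  proof (rule poly_weakly_alternating_eq_0[where t = "\<lambda>j. \<eta> (Suc j)"])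
    show "degree (smult (- ?\<phi> (\<eta> 1)) P) \<le> 2 * n"
      using degree_smult_le[of "- ?\<phi> (\<eta> 1)" P] deg by linarith
    show "(-1) ^ j * poly (smult (- ?\<phi> (\<eta> 1)) P) (\<eta> (Suc j)) \<ge> 0" if "j \<le> Suc (2 * n)" for j
    proof -
      have "(-1) ^ j * poly (smult (- ?\<phi> (\<eta> 1)) P) (\<eta> (Suc j))
          = - (((-1) ^ j * (-1) ^ j) * (?\<phi> (\<eta> (Suc j)) * poly P (\<eta> (Suc j))))"
        unfolding poly_smult alternate[OF that, symmetric]
        by (simp only: mult_minus_left mult_minus_right mult_ac)
      also have "\<dots> = - (?\<phi> (\<eta> (Suc j)) * poly P (\<eta> (Suc j)))"
        by (simp flip: power_mult_distrib)
      also have "\<dots> \<ge> 0"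
        using sign[of "\<eta> (Suc j)"] eta[of "Suc j"] that by simp
      finally show ?thesis .
    qed
  qed (rule eta_less)
  moreover have "?\<phi> (\<eta> 1) \<noteq> 0"
    using assms(3) by (force simp: equioscillation_points_def)
  ultimately have "P = 0"
    by simp
  then have "sin ((g x + g (- x)) / 2) = 0"
    using P[of x] H[of x] by simp
  moreover have "- pi < (g x + g (- x)) / 2" "(g x + g (- x)) / 2 < pi"
    using bound[OF assms(4)] \<open>?E < pi\<close> unfolding sym
    by (auto simp: abs_le_iff field_simps)
  ultimately have "(g x + g (- x)) / 2 = 0"
    using sin_eq_0_pi by blast
  then show ?thesis
    using sym[of x] by simp
qed

section \<open>Equioscillation points and nodes\<close>

lemma in_consecutive_interval:
  fixes \<eta> :: "nat \<Rightarrow> real"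
  assumes "\<eta> 1 \<le> t" "t < \<eta> (Suc m)"
  obtains j where "j \<in> {1..m}" "\<eta> j \<le> t" "t < \<eta> (Suc j)"
  using assms
proof (induction m)
  case (Suc m)
  then show ?case
    by (cases "t < \<eta> (Suc m)") force+
qed simp

text \<open>
  The intervals between consecutive equioscillation points cover \<open>{-1..1}\<close> up to those points, where
  the phase error does not vanish, so that every zero is the node of some interval.
\<close>

lemma nodes_eq_zeros:
  assumes "equioscillation_points n \<omega> g \<eta>" "node_ordinates n \<omega> g \<eta> x"
  shows "x ` {1..2*n+1} = {t\<in>{-1..1}. phase_error \<omega> g t = 0}"
proof (intro equalityI subsetI)
  fix t assume "t \<in> x ` {1..2*n+1}"
  then obtain j where j: "j \<in> {1..2*n+1}" "t = x j" by blast
  then have "t \<in> {\<eta> j<..<\<eta> (j+1)}" "phase_error \<omega> g t = 0"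
    using assms(2) unfolding node_ordinates_def by blast+
  moreover have "\<eta> j \<in> {-1..1}" "\<eta> (j+1) \<in> {-1..1}"
  proof -
    have "j \<in> {1..2*n+2}" "j + 1 \<in> {1..2*n+2}"
      using j by auto
    then show "\<eta> j \<in> {-1..1}" "\<eta> (j+1) \<in> {-1..1}"
      using assms(1) unfolding equioscillation_points_def by blast+
  qed
  ultimately show "t \<in> {t\<in>{-1..1}. phase_error \<omega> g t = 0}"
    by auto
next
  fix t assume t: "t \<in> {t\<in>{-1..1}. phase_error \<omega> g t = 0}"
  have ends: "\<eta> 1 = -1" "\<eta> (Suc (2*n+1)) = 1"
    using assms(1) by (auto simp: equioscillation_points_def)
  have eta_nz: "phase_error \<omega> g (\<eta> j) \<noteq> 0" "phase_error \<omega> g (\<eta> (j+1)) \<noteq> 0"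
    if "j \<in> {1..2*n+1}" for j
    using assms(1) that unfolding equioscillation_points_def by fastforce+
  have "t \<noteq> \<eta> (Suc (2*n+1))"
    using eta_nz(2)[of "2*n+1"] t by auto
  with t ends obtain j where j: "j \<in> {1..2*n+1}" "\<eta> j \<le> t" "t < \<eta> (Suc j)"
    using in_consecutive_interval[of \<eta> t "2*n+1"] by force
  moreover have "t \<noteq> \<eta> j"
    using eta_nz(1)[OF j(1)] t by auto
  ultimately have "t \<in> {t\<in>{\<eta> j<..<\<eta> (j+1)}. phase_error \<omega> g t = 0}"
    using t by auto
  then have "t = x j"
    using assms(2) j(1) unfolding node_ordinates_def by blast
  with j(1) show "t \<in> x ` {1..2*n+1}" by blast
qed

lemma uminus_image_eqI:
  fixes A :: "'a::ab_group_add set"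
  assumes "\<And>a. a \<in> A \<Longrightarrow> - a \<in> A"
  shows "uminus ` A = A"
  using assms by (metis image_subsetI minus_minus rev_image_eqI subsetI subset_antisym)

theorem proposition6p4:
  fixes n :: nat and \<omega> :: real
    and r :: "complex poly fract" and g :: "real \<Rightarrow> real" and \<eta> x :: "nat \<Rightarrow> real"
  assumes "n \<ge> 1"
    and "0 < \<omega>" and "\<omega> < (real n + 1) * pi"
    and "unitary_best_approx n \<omega> r"
    and "phase_function \<omega> r g"
    and "equioscillation_points n \<omega> g \<eta>"
    and "node_ordinates n \<omega> g \<eta> x"
  shows "uminus ` ((\<lambda>j. \<i> * complex_of_real (x j)) ` {1..2*n+1})
           = (\<lambda>j. \<i> * complex_of_real (x j)) ` {1..2*n+1}
       \<and> uminus ` (\<eta> ` {1..2*n+2}) = \<eta> ` {1..2*n+2}"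
proof -
  have "r \<in> unitary_rats n"
    using assms(4) by (simp add: unitary_best_approx_def)
  then have odd: "phase_error \<omega> g (- t) = - phase_error \<omega> g t" if "t \<in> {-1..1}" for t
    using phase_error_odd assms(5,6) that by blast
  have eta: "\<eta> ` {1..2*n+2} = {t\<in>{-1..1}. \<bar>phase_error \<omega> g t\<bar> = max_phase_error \<omega> g}"
    using assms(6) by (simp add: equioscillation_points_def)
  have nodes: "(\<lambda>j. \<i> * complex_of_real (x j)) ` {1..2*n+1}
      = (\<lambda>t. \<i> * complex_of_real t) ` {t\<in>{-1..1}. phase_error \<omega> g t = 0}"
    unfolding nodes_eq_zeros[OF assms(6,7), symmetric] image_image ..
  show ?thesis
  proof
    show "uminus ` ((\<lambda>j. \<i> * complex_of_real (x j)) ` {1..2*n+1})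
        = (\<lambda>j. \<i> * complex_of_real (x j)) ` {1..2*n+1}"
      unfolding nodes
    proof (rule uminus_image_eqI)
      fix z
      assume "z \<in> (\<lambda>t. \<i> * complex_of_real t) ` {t\<in>{-1..1}. phase_error \<omega> g t = 0}"
      then obtain t where "z = \<i> * complex_of_real t" "t \<in> {-1..1}" "phase_error \<omega> g t = 0"
        by blast
      then show "- z \<in> (\<lambda>t. \<i> * complex_of_real t) ` {t\<in>{-1..1}. phase_error \<omega> g t = 0}"
        using odd by (intro image_eqI[of _ _ "- t"]) auto
    qed
    show "uminus ` (\<eta> ` {1..2*n+2}) = \<eta> ` {1..2*n+2}"
      unfolding eta using odd by (intro uminus_image_eqI) auto
  qed
qed

end
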